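(* Let $k$ be a real number with $9k^2>8$, let $\lambda_1=\frac{3k+\sqrt{9k^2-8}}{2}$, $\lambda_2=\frac{3k-\sqrt{9k^2-8}}{2}$, and let $\alpha=\sum_{r=0}^{7}\lambda_1^{r}e_r$, $\beta=\sum_{r=0}^{7}\lambda_2^{r}e_r$ in $\mathbb{O}$. Then for all nonnegative integers $n,i,j$: $$m\mathbb{O}_{k,n+i}m\mathbb{O}_{k,n+j}-m\mathbb{O}_{k,n}m\mathbb{O}_{k,n+i+j}=2^{n}M_{k,i}\sqrt{9k^2-8}\,\left(\alpha\beta\lambda_2^{j}-\beta\alpha\lambda_1^{j}\right).$$
   Context: $\mathbb{O}$ denotes the octonions, the $8$-dimensional real (non-commutative, non-associative) algebra with basis $e_0=1,e_1,\dots,e_7$ and bilinear multiplication determined by: $e_0$ is the identity, $e_a^2=-1$ for $a\ge1$, $e_ae_b=-e_be_a$ for distinct $a,b\ge1$, and $e_ae_b=e_c$, $e_be_c=e_a$, $e_ce_a=e_b$ for $(a,b,c)\in\{(1,2,3),(1,4,5),(1,7,6),(2,4,6),(2,5,7),(3,4,7),(3,6,5)\}$. The $k$-Mersenne numbers are defined by $M_{k,0}=0$, $M_{k,1}=1$, $M_{k,n+1}=3kM_{k,n}-2M_{k,n-1}$ for $n\ge1$. The $k$-Mersenne-Lucas numbers are defined by $m_{k,0}=2$, $m_{k,1}=3k$, $m_{k,n+1}=3km_{k,n}-2m_{k,n-1}$ for $n\ge1$. The $n$-th $k$-Mersenne-Lucas octonion is $m\mathbb{O}_{k,n}=\sum_{r=0}^{7}m_{k,n+r}e_r$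 for $n\ge 0$. *)

theory Defs
  imports "HOL-Analysis.Analysis"
begin

section \<open>Octonions\<close>

text \<open>The index type \<^typ>\<open>8\<close> has the eight elements 0, 1, ..., 7 (arithmetic on it is modulo 8).\<close>

typedef octonion = "UNIV :: (real ^ 8) set"
  morphisms oct_coords Abs_octonion ..

setup_lifting type_definition_octonion

instantiation octonion :: real_vector
begin

lift_definition zero_octonion :: octonion is "0" .
lift_definition plus_octonion :: "octonion \<Rightarrow> octonion \<Rightarrow> octonion" is "(+)" .
lift_definition minus_octonion :: "octonion \<Rightarrow> octonion \<Rightarrow> octonion" is "(-)" .
lift_definition uminus_octonion :: "octonion \<Rightarrow> octonion" is "uminus" .
lift_definition scaleR_octonion :: "real \<Rightarrow> octonion \<Rightarrow> octonion" is "scaleR" .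

instance
  by standard (transfer; simp add: algebra_simps)+

end

text \<open>The basis vectors are \<open>oct_unit r\<close> for r = 0, ..., 7; larger r are reduced modulo 8.\<close>

lift_definition oct_unit :: "nat \<Rightarrow> octonion" is "\<lambda>r. axis (of_nat r) 1" .

definition oct_triples :: "(8 \<times> 8 \<times> 8) set" where
  "oct_triples = {(1,2,3), (1,4,5), (1,7,6), (2,4,6), (2,5,7), (3,4,7), (3,6,5)}"

definition oct_cyclic :: "8 \<Rightarrow> 8 \<Rightarrow> 8 \<Rightarrow> bool" where
  "oct_cyclic a b c \<longleftrightarrow>
     (a, b, c) \<in> oct_triples \<or> (b, c, a) \<in> oct_triples \<or> (c, a, b) \<in> oct_triples"

text \<open>Structure constants: the coefficient of the c-th basis vector in the product
  of the a-th and the b-th one.\<close>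

definition oct_struct :: "8 \<Rightarrow> 8 \<Rightarrow> 8 \<Rightarrow> real" where
  "oct_struct a b c =
     (if a = 0 then of_bool (c = b)
      else if b = 0 then of_bool (c = a)
      else if a = b then - of_bool (c = 0)
      else of_bool (oct_cyclic a b c) - of_bool (oct_cyclic b a c))"

instantiation octonion :: "{one, times}"
begin

definition one_octonion :: octonion where
  "one_octonion = oct_unit 0"

lift_definition times_octonion :: "octonion \<Rightarrow> octonion \<Rightarrow> octonion" is
  "\<lambda>x y. \<chi> c. \<Sum>a\<in>UNIV. \<Sum>b\<in>UNIV. oct_struct a b c * (x $ a * y $ b)" .

instance ..

end

text \<open>The defining properties of the octonion product: it is bilinear with the prescribed
  multiplication table on the basis.\<close>

lemma oct_mult_add_left: "(x + y) * z = x * z + y * (z :: octonion)"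
  by transfer (simp add: vec_eq_iff algebra_simps sum.distrib)

lemma oct_mult_add_right: "x * (y + z) = x * y + x * (z :: octonion)"
  by transfer (simp add: vec_eq_iff algebra_simps sum.distrib)

lemma oct_mult_scaleR_left: "(r *\<^sub>R x) * y = r *\<^sub>R (x * (y :: octonion))"
  by transfer (simp add: vec_eq_iff sum_distrib_left mult_ac)

lemma oct_mult_scaleR_right: "x * (r *\<^sub>R y) = r *\<^sub>R (x * (y :: octonion))"
  by transfer (simp add: vec_eq_iff sum_distrib_left mult_ac)

lemma oct_eq_iff: "x = y \<longleftrightarrow> (\<forall>c. oct_coords x $ c = oct_coords y $ c)"
  by transfer (simp add: vec_eq_iff)

lemma oct_coords_zero [simp]: "oct_coords 0 $ c = 0"
  by transfer simp

lemma oct_coords_add [simp]: "oct_coords (x + y) $ c = oct_coords x $ c + oct_coords y $ c"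
  by transfer simp

lemma oct_coords_uminus [simp]: "oct_coords (- x) $ c = - (oct_coords x $ c)"
  by transfer simp

lemma oct_coords_scaleR [simp]: "oct_coords (r *\<^sub>R x) $ c = r * (oct_coords x $ c)"
  by transfer simp

lemma oct_coords_sum [simp]: "oct_coords (sum f A) $ c = (\<Sum>r\<in>A. oct_coords (f r) $ c)"
  by (induction A rule: infinite_finite_induct) simp_all

lemma oct_coords_unit: "oct_coords (oct_unit r) $ c = of_bool (c = of_nat r)"
  by transfer (simp add: axis_def)

lemma oct_coords_mult: "oct_coords (x * y) $ c =
    (\<Sum>a\<in>UNIV. \<Sum>b\<in>UNIV. oct_struct a b c * (oct_coords x $ a * oct_coords y $ b))"
  by transfer simp

lemma oct_coords_unit_mult:
  "oct_coords (oct_unit a * oct_unit b) $ c = oct_struct (of_nat a) (of_nat b) c"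
proof -
  define A B where "A = (of_nat a :: 8)" and "B = (of_nat b :: 8)"
  have "oct_struct p q c * (of_bool (p = A) * of_bool (q = B))
      = (if p = A then (if q = B then oct_struct A B c else 0) else 0)" for p q
    by simp
  moreover have "(\<Sum>q\<in>UNIV. if p = A then (if q = B then oct_struct A B c else 0) else 0)
      = (if p = A then oct_struct A B c else 0)" for p
    by (cases "p = A") simp_all
  ultimately show ?thesis
    by (simp add: oct_coords_mult oct_coords_unit A_def B_def)
qed

lemma UNIV_8: "(UNIV :: 8 set) = {0, 1, 2, 3, 4, 5, 6, 7}"
proof (rule sym, rule card_subset_eq)
  show "card {0, 1, 2, 3, 4, 5, 6, 7 :: 8} = card (UNIV :: 8 set)"
    by simp
qed auto

lemma of_nat_8_inj:
  assumes "a \<le> 7" "b \<le> 7"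
  shows "(of_nat a :: 8) = of_nat b \<longleftrightarrow> a = b"
proof -
  have "a \<in> {0,1,2,3,4,5,6,7}" "b \<in> {0,1,2,3,4,5,6,7}"
    using assms by auto
  then show ?thesis by (elim insertE emptyE; simp)
qed

lemma of_nat_8_eq_0: "1 \<le> a \<Longrightarrow> a \<le> 7 \<Longrightarrow> (of_nat a :: 8) \<noteq> 0"
  using of_nat_8_inj[of a 0] by simp

lemma oct_expand: "x = (\<Sum>r=0..7. (oct_coords x $ of_nat r) *\<^sub>R oct_unit r)"
proof (unfold oct_eq_iff, rule allI)
  fix c :: 8
  have "c \<in> of_nat ` {0..7}"
  proof -
    have "c \<in> {0, 1, 2, 3, 4, 5, 6, 7}" using UNIV_8 by blast
    also have "\<dots> = of_nat ` {0, 1, 2, 3, 4, 5, 6, 7}" by simp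
    also have "\<dots> \<subseteq> of_nat ` {0..7}" by (rule image_mono) simp
    finally show ?thesis .
  qed
  then obtain s where s: "c = of_nat s" "s \<le> 7" by auto
  have "(\<Sum>r=0..7. (oct_coords x $ of_nat r) * of_bool (c = of_nat r))
      = (\<Sum>r=0..7. if r = s then oct_coords x $ of_nat s else 0)"
    using s of_nat_8_inj by (intro sum.cong) auto
  then show "oct_coords x $ c = oct_coords (\<Sum>r=0..7. (oct_coords x $ of_nat r) *\<^sub>R oct_unit r) $ c"
    using s by (simp add: oct_coords_unit)
qed

lemma oct_mult_1_left: "1 * x = (x :: octonion)"
proof -
  have "(\<Sum>b\<in>UNIV. oct_struct a b c * (of_bool (a = 0) * oct_coords x $ b))
      = (if a = 0 then oct_coords x $ c else 0)" for a c
    by (cases "a = 0") (simp_all add: oct_struct_def)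
  then show ?thesis
    by (simp add: oct_eq_iff oct_coords_mult oct_coords_unit one_octonion_def)
qed

lemma oct_mult_1_right: "x * 1 = (x :: octonion)"
proof -
  have *: "oct_struct a b c * (oct_coords x $ a * of_bool (b = 0))
      = (if b = 0 then (if a = c then oct_coords x $ c else 0) else 0)" for a b c
    by (auto simp: oct_struct_def)
  show ?thesis
    by (simp add: oct_eq_iff oct_coords_mult oct_coords_unit one_octonion_def *)
qed

lemma oct_unit_square:
  assumes "1 \<le> a" "a \<le> 7"
  shows "oct_unit a * oct_unit a = - 1"
  using of_nat_8_eq_0[OF assms]
  by (simp add: oct_eq_iff oct_coords_unit_mult oct_coords_unit oct_struct_def one_octonion_def)

lemma oct_unit_anticommute:
  assumes "1 \<le> a" "a \<le> 7" "1 \<le> b" "b \<le> 7" "a \<noteq> b"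
  shows "oct_unit a * oct_unit b = - (oct_unit b * oct_unit a)"
proof -
  have "(of_nat a :: 8) \<noteq> 0" "(of_nat b :: 8) \<noteq> 0" "(of_nat a :: 8) \<noteq> of_nat b"
    using assms of_nat_8_eq_0 of_nat_8_inj by auto
  then show ?thesis
    by (auto simp: oct_eq_iff oct_coords_unit_mult oct_struct_def)
qed

lemma oct_unit_triple:
  assumes "(a, b, c) \<in> {(1,2,3), (1,4,5), (1,7,6), (2,4,6), (2,5,7), (3,4,7), (3,6,5)}"
  shows "oct_unit a * oct_unit b = oct_unit c"
    and "oct_unit b * oct_unit c = oct_unit a"
    and "oct_unit c * oct_unit a = oct_unit b"
  using assms unfolding insert_iff empty_iff prod.inject
  by (elim disjE conjE FalseE; simp add: oct_eq_iff oct_coords_unit_mult oct_coords_unit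
      oct_struct_def oct_cyclic_def oct_triples_def)+

section \<open>Mersenne and Mersenne-Lucas numbers\<close>

fun mersenne :: "real \<Rightarrow> nat \<Rightarrow> real" where
  "mersenne k 0 = 0"
| "mersenne k (Suc 0) = 1"
| "mersenne k (Suc (Suc n)) = 3 * k * mersenne k (Suc n) - 2 * mersenne k n"

fun mersenne_lucas :: "real \<Rightarrow> nat \<Rightarrow> real" where
  "mersenne_lucas k 0 = 2"
| "mersenne_lucas k (Suc 0) = 3 * k"
| "mersenne_lucas k (Suc (Suc n)) = 3 * k * mersenne_lucas k (Suc n) - 2 * mersenne_lucas k n"

definition mersenne_lucas_oct :: "real \<Rightarrow> nat \<Rightarrow> octonion" where
  "mersenne_lucas_oct k n = (\<Sum>r=0..7. mersenne_lucas k (n + r) *\<^sub>R oct_unit r)"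

end

theory Submission
  imports Defs
begin

text \<open>
  Both scalar sequences are combinations of the powers of the roots \<open>a\<close>, \<open>b\<close> of
  \<open>x\<^sup>2 = 3 k x - 2\<close> (Binet's formulas), so the Mersenne-Lucas octonion of index \<open>n\<close> is
  \<open>a\<^sup>n \<alpha> + b\<^sup>n \<beta>\<close>. When the two products on the left-hand side are expanded by bilinearity, the
  \<open>\<alpha> \<alpha>\<close> and \<open>\<beta> \<beta>\<close> terms cancel because the indices have the same sum \<open>2 n + i + j\<close> in both
  products. The mixed terms share the factor \<open>(a b)\<^sup>n (a\<^sup>i - b\<^sup>i)\<close>, in which \<open>a b = 2\<close> and
  \<open>a\<^sup>i - b\<^sup>i\<close> is \<open>a - b\<close> times the Mersenne number of index \<open>i\<close>. Since \<open>\<alpha>\<close> and \<open>\<beta>\<close> do not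
  commute, \<open>\<alpha> \<beta>\<close> and \<open>\<beta> \<alpha>\<close> remain separate.
\<close>

lemma root_power_recurrence:
  fixes a b c d :: "'a :: comm_ring_1"
  assumes "a + b = c" "a * b = d"
  shows "a ^ Suc (Suc n) = c * a ^ Suc n - d * a ^ n"
  by (simp add: assms[symmetric] algebra_simps)

lemma mersenne_binet:
  assumes "a + b = 3 * k" "a * b = 2"
  shows "mersenne k n * (a - b) = a ^ n - b ^ n"
proof (induction n rule: induct_nat_012)
  case (ge2 n)
  have "mersenne k (Suc (Suc n)) * (a - b)
      = 3 * k * (mersenne k (Suc n) * (a - b)) - 2 * (mersenne k n * (a - b))"
    by (simp add: algebra_simps)
  also have "\<dots> = a ^ Suc (Suc n) - b ^ Suc (Suc n)"
    using assms root_power_recurrence[of a b "3 * k" 2 n] root_power_recurrence[of b a "3 * k" 2 n]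
    unfolding ge2 by (simp add: add.commute mult.commute right_diff_distrib)
  finally show ?case .
qed simp_all

lemma mersenne_lucas_binet:
  assumes "a + b = 3 * k" "a * b = 2"
  shows "mersenne_lucas k n = a ^ n + b ^ n"
proof (induction n rule: induct_nat_012)
  case (ge2 n)
  have "mersenne_lucas k (Suc (Suc n)) = 3 * k * (a ^ Suc n + b ^ Suc n) - 2 * (a ^ n + b ^ n)"
    by (simp only: mersenne_lucas.simps ge2)
  also have "\<dots> = a ^ Suc (Suc n) + b ^ Suc (Suc n)"
    using assms root_power_recurrence[of a b "3 * k" 2 n] root_power_recurrence[of b a "3 * k" 2 n]
    by (simp add: add.commute mult.commute distrib_left)
  finally show ?case .
qed (use assms in simp_all)

lemma mersenne_lucas_oct_binet:
  assumes "a + b = 3 * k" "a * b = 2"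
  shows "mersenne_lucas_oct k n =
      (a ^ n) *\<^sub>R (\<Sum>r=0..7. (a ^ r) *\<^sub>R oct_unit r)
    + (b ^ n) *\<^sub>R (\<Sum>r=0..7. (b ^ r) *\<^sub>R oct_unit r)"
  by (simp add: mersenne_lucas_oct_def mersenne_lucas_binet[OF assms] power_add
      scaleR_left_distrib sum.distrib scaleR_sum_right)

text \<open>
  Bilinearity of the product makes the coefficients of \<open>x x\<close> and \<open>y y\<close> equal to
  \<open>a\<^sup>2\<^sup>n\<^sup>+\<^sup>i\<^sup>+\<^sup>j\<close> and \<open>b\<^sup>2\<^sup>n\<^sup>+\<^sup>i\<^sup>+\<^sup>j\<close> in both products, so only the mixed terms survive.
\<close>

lemma oct_power_combination_product_diff:
  fixes a b :: real and x y :: octonion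
  defines "u \<equiv> \<lambda>n. (a ^ n) *\<^sub>R x + (b ^ n) *\<^sub>R y"
  shows "u (n + i) * u (n + j) - u n * u (n + i + j)
       = ((a * b) ^ n * (a ^ i - b ^ i)) *\<^sub>R ((b ^ j) *\<^sub>R (x * y) - (a ^ j) *\<^sub>R (y * x))"
  by (simp add: u_def oct_mult_add_left oct_mult_add_right oct_mult_scaleR_left
      oct_mult_scaleR_right power_add power_mult_distrib algebra_simps)

theorem theorem3p6:
  fixes k lambda1 lambda2 :: real and \<alpha> \<beta> :: octonion and n i j :: nat
  assumes "9 * k\<^sup>2 > 8"
    and "lambda1 = (3 * k + sqrt (9 * k\<^sup>2 - 8)) / 2"
    and "lambda2 = (3 * k - sqrt (9 * k\<^sup>2 - 8)) / 2"
    and "\<alpha> = (\<Sum>r=0..7. (lambda1 ^ r) *\<^sub>R oct_unit r)"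
    and "\<beta> = (\<Sum>r=0..7. (lambda2 ^ r) *\<^sub>R oct_unit r)"
  shows "mersenne_lucas_oct k (n + i) * mersenne_lucas_oct k (n + j)
           - mersenne_lucas_oct k n * mersenne_lucas_oct k (n + i + j)
         = (2 ^ n * mersenne k i * sqrt (9 * k\<^sup>2 - 8)) *\<^sub>R
             ((lambda2 ^ j) *\<^sub>R (\<alpha> * \<beta>) - (lambda1 ^ j) *\<^sub>R (\<beta> * \<alpha>))"
proof -
  have sum: "lambda1 + lambda2 = 3 * k"
    and diff: "lambda1 - lambda2 = sqrt (9 * k\<^sup>2 - 8)"
    using assms(2,3) by (simp_all add: field_simps)
  have "4 * (lambda1 * lambda2) = (lambda1 + lambda2)\<^sup>2 - (lambda1 - lambda2)\<^sup>2"
    by (simp add: power2_eq_square algebra_simps)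
  then have prod: "lambda1 * lambda2 = 2"
    using assms(1) by (simp add: sum diff power_mult_distrib)
  have "mersenne_lucas_oct k m = (lambda1 ^ m) *\<^sub>R \<alpha> + (lambda2 ^ m) *\<^sub>R \<beta>" for m
    unfolding assms(4,5) by (rule mersenne_lucas_oct_binet[OF sum prod])
  then show ?thesis
    using oct_power_combination_product_diff[of lambda1 n i \<alpha> lambda2 \<beta> j]
    by (simp add: prod mersenne_binet[OF sum prod, symmetric] diff mult.assoc)
qed

end
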